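(* Let $h$ be a function with polynomial growth belonging to a Hardy field, and suppose that $\lim_{x\to\infty}\frac{|h(x)-p(x)|}{x}=\infty$ for all $p\in\mathbb{Q}[x]$ and that there exists $q\in\mathbb{Q}[x]$ with $\lim_{x\to\infty}\frac{|h(x)-q(x)|}{x\log x}=0$. Then it is not the case that $\lim_{N\to\infty}\mathbb{E}^{\mathrm{bin}}_{n\le N}e^{2\pi i h(n)}=0$.
   Context: Polynomial growth: there exist $c,d\ge1$ with $|h(x)|\le x^d$ for $x\ge c$. A Hardy field is a field of germs at $\infty$ of real-valued differentiable functions closed under differentiation. $\mathbb{E}^{\mathrm{bin}}_{n\le N}a_n=\frac{1}{2^N}\sum_{n=1}^N\binom{N}{n}a_n$. *)

theory Defs
  imports "HOL-Analysis.Derivative" "HOL-Computational_Algebra.Polynomial"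
begin

section \<open>Germs at infinity of real functions\<close>

definition eventually_equal :: "(real \<Rightarrow> real) \<Rightarrow> (real \<Rightarrow> real) \<Rightarrow> bool" where
  "eventually_equal f g \<longleftrightarrow> (\<forall>\<^sub>F x in at_top. f x = g x)"

lemma equivp_eventually_equal: "equivp eventually_equal"
proof (rule equivpI)
  show "reflp eventually_equal"
    by (simp add: reflp_def eventually_equal_def)
  show "symp eventually_equal"
    by (simp add: symp_def eventually_equal_def eq_commute)
  show "transp eventually_equal"
    unfolding transp_def eventually_equal_def
  proof (intro allI impI)
    fix f g k :: "real \<Rightarrow> real"
    assume "\<forall>\<^sub>F x in at_top. f x = g x" "\<forall>\<^sub>F x in at_top. g x = k x"
    then show "\<forall>\<^sub>F x in at_top. f x = k x"
      by eventually_elim simp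
  qed
qed

quotient_type germ = "real \<Rightarrow> real" / eventually_equal
  morphisms rep_germ germ_of
  by (rule equivp_eventually_equal)

instantiation germ :: comm_ring_1
begin

lift_definition zero_germ :: germ is "\<lambda>x. 0" .

lift_definition one_germ :: germ is "\<lambda>x. 1" .

lift_definition plus_germ :: "germ \<Rightarrow> germ \<Rightarrow> germ" is "\<lambda>f g x. f x + g x"
  unfolding eventually_equal_def by (erule (1) eventually_elim2) simp

lift_definition minus_germ :: "germ \<Rightarrow> germ \<Rightarrow> germ" is "\<lambda>f g x. f x - g x"
  unfolding eventually_equal_def by (erule (1) eventually_elim2) simp

lift_definition uminus_germ :: "germ \<Rightarrow> germ" is "\<lambda>f x. - f x"
  unfolding eventually_equal_def by (erule eventually_mono) simp

lift_definition times_germ :: "germ \<Rightarrow> germ \<Rightarrow> germ" is "\<lambda>f g x. f x * g x"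
  unfolding eventually_equal_def by (erule (1) eventually_elim2) simp

instance
proof
  fix a b c :: germ
  show "a + b + c = a + (b + c)"
    by transfer (simp add: eventually_equal_def add.assoc)
  show "a + b = b + a"
    by transfer (simp add: eventually_equal_def add.commute)
  show "0 + a = a"
    by transfer (simp add: eventually_equal_def)
  show "- a + a = 0"
    by transfer (simp add: eventually_equal_def)
  show "a - b = a + - b"
    by transfer (simp add: eventually_equal_def)
  show "a * b * c = a * (b * c)"
    by transfer (simp add: eventually_equal_def mult.assoc)
  show "a * b = b * a"
    by transfer (simp add: eventually_equal_def mult.commute)
  show "1 * a = a"
    by transfer (simp add: eventually_equal_def)
  show "(a + b) * c = a * c + b * c"
    by transfer (simp add: eventually_equal_def distrib_right)
  show "(0::germ) \<noteq> 1"
    by transfer (simp add: eventually_equal_def)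
qed

end

lemma eventually_equal_nhds:
  assumes "eventually_equal f g"
  shows "\<forall>\<^sub>F x in at_top. \<forall>\<^sub>F y in nhds x. f y = g y"
proof -
  obtain a where a: "\<And>x. x \<ge> a \<Longrightarrow> f x = g x"
    using assms unfolding eventually_equal_def eventually_at_top_linorder by blast
  have "\<forall>\<^sub>F y in nhds x. f y = g y" if "x > a" for x
    by (rule eventually_mono[OF eventually_nhds_in_open[of "{a<..}" x]]) (use that a in auto)
  then show ?thesis
    by (rule eventually_mono[OF eventually_gt_at_top[of a]])
qed

lift_definition germ_differentiable :: "germ \<Rightarrow> bool" is
  "\<lambda>f. \<forall>\<^sub>F x in at_top. f differentiable (at x)"
proof -
  have "\<forall>\<^sub>F x in at_top. g differentiable (at x)"
    if "eventually_equal f g" "\<forall>\<^sub>F x in at_top. f differentiable (at x)" for f g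
    using eventually_equal_nhds[OF that(1)] that(2)
  proof eventually_elim
    case (elim x)
    obtain D where "(f has_real_derivative D) (at x)"
      using elim(2) by (auto simp: real_differentiable_def)
    then have "(g has_real_derivative D) (at x)"
      using DERIV_cong_ev[OF refl elim(1) refl] by blast
    then show ?case
      by (auto simp: real_differentiable_def)
  qed
  moreover have "eventually_equal g f" if "eventually_equal f g" for f g
    using that by (simp add: eventually_equal_def eq_commute)
  ultimately show "\<And>f g. eventually_equal f g \<Longrightarrow>
      (\<forall>\<^sub>F x in at_top. f differentiable (at x)) = (\<forall>\<^sub>F x in at_top. g differentiable (at x))"
    by blast
qed

text \<open>Meaningful only for differentiable germs, as \<^const>\<open>deriv\<close> is arbitrary elsewhere.\<close>

lift_definition germ_deriv :: "germ \<Rightarrow> germ" is "deriv"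
  subgoal premises prems for f g
    unfolding eventually_equal_def using eventually_equal_nhds[OF prems]
    by eventually_elim (rule deriv_cong_ev[OF _ refl])
  done


section \<open>Hardy fields, rational polynomials and growth\<close>

text \<open>
  The type of germs is only a ring, so the field property requires an inverse for every
  nonzero element.
\<close>

definition hardy_field :: "germ set \<Rightarrow> bool" where
  "hardy_field H \<longleftrightarrow>
     0 \<in> H \<and> 1 \<in> H \<and>
     (\<forall>f\<in>H. \<forall>g\<in>H. f + g \<in> H) \<and>
     (\<forall>f\<in>H. - f \<in> H) \<and>
     (\<forall>f\<in>H. \<forall>g\<in>H. f * g \<in> H) \<and>
     (\<forall>f\<in>H. f \<noteq> 0 \<longrightarrow> (\<exists>g\<in>H. f * g = 1)) \<and>
     (\<forall>f\<in>H. germ_differentiable f) \<and>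
     (\<forall>f\<in>H. germ_deriv f \<in> H)"

definition rat_poly_eval :: "rat poly \<Rightarrow> real \<Rightarrow> real" where
  "rat_poly_eval p x = poly (map_poly of_rat p) x"

definition polynomial_growth :: "(real \<Rightarrow> real) \<Rightarrow> bool" where
  "polynomial_growth h \<longleftrightarrow> (\<exists>c\<ge>1. \<exists>d\<ge>1. \<forall>x\<ge>c. \<bar>h x\<bar> \<le> x powr d)"


section \<open>Binomial averages\<close>

definition binomial_average :: "(nat \<Rightarrow> complex) \<Rightarrow> nat \<Rightarrow> complex" where
  "binomial_average a N = 1 / 2 ^ N * (\<Sum>n=1..N. of_nat (N choose n) * a n)"

end

theory Submission
  imports Defs "HOL-Analysis.Analysis"
begin

text \<open>
  Write $h = q + g$ with $q$ rational and $g = o(x \log x)$. Since $g'' - c/x$ has eventually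
  constant sign for every rational $c$, the growth of $g$ forces $g'' = o(1/x)$; hence $g$ is within
  $o(1)$ of its tangent line on windows of length $O(\sqrt{N})$ around $N/2$, where the binomial
  weights concentrate. So near $x$ with $N \approx 2x$ the sequence $e(h(n))$ behaves like a constant
  times $e(q(n) + n g'(x))$. As $e(q(n))$ is periodic, it has a nonzero Fourier coefficient $c_k$ at
  some frequency $k/D$, and since $g'$ is unbounded and continuous, there are arbitrarily large $x$
  with $g'(x) \in -k/D + \mathbb{Z}$. Along these, the average has modulus close to $|c_k|$.
\<close>

section \<open>Eventual signs in Hardy fields\<close>

text \<open>Weak inequalities admit the zero function, so that every germ of a Hardy field can
  qualify.\<close>

definition eventually_signed :: "(real \<Rightarrow> real) \<Rightarrow> bool" where
  "eventually_signed f \<longleftrightarrow> (\<forall>\<^sub>F x in at_top. 0 \<le> f x) \<or> (\<forall>\<^sub>F x in at_top. f x \<le> 0)"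

lemma eventually_signed_mult:
  assumes "eventually_signed f" "eventually_signed g"
  shows "eventually_signed (\<lambda>x. f x * g x)"
proof -
  have *: "\<forall>\<^sub>F x in at_top. R (f x * g x)"
    if "\<forall>\<^sub>F x in at_top. P (f x)" "\<forall>\<^sub>F x in at_top. Q (g x)" "\<And>a b :: real. P a \<Longrightarrow> Q b \<Longrightarrow> R (a * b)" for P Q R
    using that(1,2) by eventually_elim (rule that(3))
  from assms consider
      "\<forall>\<^sub>F x in at_top. 0 \<le> f x" "\<forall>\<^sub>F x in at_top. 0 \<le> g x"
    | "\<forall>\<^sub>F x in at_top. 0 \<le> f x" "\<forall>\<^sub>F x in at_top. g x \<le> 0"
    | "\<forall>\<^sub>F x in at_top. f x \<le> 0" "\<forall>\<^sub>F x in at_top. 0 \<le> g x"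
    | "\<forall>\<^sub>F x in at_top. f x \<le> 0" "\<forall>\<^sub>F x in at_top. g x \<le> 0"
    unfolding eventually_signed_def by blast
  then show ?thesis
  proof cases
    case 1
    have "\<forall>\<^sub>F x in at_top. 0 \<le> f x * g x"
      by (rule *[OF 1]) simp
    then show ?thesis by (simp add: eventually_signed_def)
  next
    case 2
    have "\<forall>\<^sub>F x in at_top. f x * g x \<le> 0"
      by (rule *[OF 2]) (rule mult_nonneg_nonpos)
    then show ?thesis by (simp add: eventually_signed_def)
  next
    case 3
    have "\<forall>\<^sub>F x in at_top. f x * g x \<le> 0"
      by (rule *[OF 3]) (rule mult_nonpos_nonneg)
    then show ?thesis by (simp add: eventually_signed_def)
  next
    case 4
    have "\<forall>\<^sub>F x in at_top. 0 \<le> f x * g x"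
      by (rule *[OF 4]) (rule mult_nonpos_nonpos)
    then show ?thesis by (simp add: eventually_signed_def)
  qed
qed

lemma eventually_signed_uminus:
  "eventually_signed (\<lambda>x. - f x) \<longleftrightarrow> eventually_signed f"
  unfolding eventually_signed_def by auto

lemma eventually_signed_cong:
  assumes "\<forall>\<^sub>F x in at_top. f x = g x" "eventually_signed f"
  shows "eventually_signed g"
proof -
  have "\<forall>\<^sub>F x in at_top. P (g x)" if "\<forall>\<^sub>F x in at_top. P (f x)" for P
    using that assms(1) by eventually_elim simp
  from this[of "\<lambda>y. 0 \<le> y"] this[of "\<lambda>y. y \<le> 0"] show ?thesis
    using assms(2) unfolding eventually_signed_def by blast
qed

text \<open>A sign of \<open>f'\<close> makes \<open>f\<close> eventually monotone, and a monotone
  function changes sign at most once. This is the integration step that undoes a differentiation in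
  the inductions on the degree.\<close>

lemma eventually_signed_antideriv:
  assumes "\<forall>\<^sub>F x in at_top. (f has_real_derivative f' x) (at x)" "eventually_signed f'"
  shows "eventually_signed f"
proof -
  have *: "eventually_signed f"
    if deriv: "\<forall>\<^sub>F x in at_top. (f has_real_derivative f' x) (at x)"
      and nonneg: "\<forall>\<^sub>F x in at_top. 0 \<le> f' x" for f f' :: "real \<Rightarrow> real"
  proof -
    obtain a where a: "\<And>x. x \<ge> a \<Longrightarrow> (f has_real_derivative f' x) (at x) \<and> 0 \<le> f' x"
      using eventually_conj[OF deriv nonneg] unfolding eventually_at_top_linorder by blast
    have mono: "f x \<le> f y" if "a \<le> x" "x \<le> y" for x y
      by (rule DERIV_nonneg_imp_nondecreasing[OF that(2)]) (use a that in \<open>meson order_trans\<close>)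
    show ?thesis
    proof (cases "\<exists>x\<ge>a. 0 \<le> f x")
      case True
      then obtain x where "x \<ge> a" "0 \<le> f x" by blast
      then have "\<forall>y\<ge>x. 0 \<le> f y"
        using mono by (meson order_trans)
      then show ?thesis
        unfolding eventually_signed_def eventually_at_top_linorder by blast
    next
      case False
      then have "\<forall>y\<ge>a. f y \<le> 0" by force
      then show ?thesis
        unfolding eventually_signed_def eventually_at_top_linorder by blast
    qed
  qed
  show ?thesis
    using assms(2) unfolding eventually_signed_def[of f']
  proof
    assume "\<forall>\<^sub>F x in at_top. f' x \<le> 0"
    moreover have "\<forall>\<^sub>F x in at_top. ((\<lambda>x. - f x) has_real_derivative - f' x) (at x)"
      using assms(1) by eventually_elim (rule DERIV_minus)
    ultimately have "eventually_signed (\<lambda>x. - f x)"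
      using * by simp
    then show ?thesis
      by (simp add: eventually_signed_uminus)
  qed (use * assms(1) in blast)
qed

context
  fixes H :: "germ set"
  assumes hardy: "hardy_field H"
begin

lemma hardy_closed:
  shows germ_zero: "germ_of (\<lambda>x. 0) \<in> H"
    and germ_one: "germ_of (\<lambda>x. 1) \<in> H"
    and germ_add: "germ_of f \<in> H \<Longrightarrow> germ_of g \<in> H \<Longrightarrow> germ_of (\<lambda>x. f x + g x) \<in> H"
    and germ_uminus: "germ_of f \<in> H \<Longrightarrow> germ_of (\<lambda>x. - f x) \<in> H"
    and germ_mult: "germ_of f \<in> H \<Longrightarrow> germ_of g \<in> H \<Longrightarrow> germ_of (\<lambda>x. f x * g x) \<in> H"
    and germ_deriv: "germ_of f \<in> H \<Longrightarrow> germ_of (deriv f) \<in> H"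
  using hardy unfolding hardy_field_def
  by (metis zero_germ.abs_eq one_germ.abs_eq plus_germ.abs_eq uminus_germ.abs_eq
      times_germ.abs_eq germ_deriv.abs_eq)+

lemma germ_diff:
  assumes "germ_of f \<in> H" "germ_of g \<in> H"
  shows "germ_of (\<lambda>x. f x - g x) \<in> H"
  using germ_add[OF assms(1) germ_uminus[OF assms(2)]] by simp

lemma germ_has_deriv:
  assumes "germ_of f \<in> H"
  shows "\<forall>\<^sub>F x in at_top. (f has_real_derivative deriv f x) (at x)"
proof -
  have "germ_differentiable (germ_of f)"
    using hardy assms unfolding hardy_field_def by blast
  then have "\<forall>\<^sub>F x in at_top. f differentiable (at x)"
    by (simp add: germ_differentiable.abs_eq)
  then show ?thesis
    by eventually_elim (simp add: DERIV_deriv_iff_real_differentiable)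
qed

text \<open>A representative \<open>g'\<close> of the inverse germ satisfies
  \<open>f x * g' x = 1\<close> eventually, which forces \<open>f x\<close> to be nonzero and
  identifies \<open>g'\<close> with the pointwise reciprocal.\<close>

lemma germ_reciprocal:
  assumes "germ_of f \<in> H" "\<not> (\<forall>\<^sub>F x in at_top. f x = 0)"
  shows "\<forall>\<^sub>F x in at_top. f x \<noteq> 0" and "germ_of (\<lambda>x. 1 / f x) \<in> H"
proof -
  have "germ_of f \<noteq> 0"
    using assms(2) by (simp add: zero_germ.abs_eq germ.abs_eq_iff eventually_equal_def)
  then obtain g where g: "g \<in> H" "germ_of f * g = 1"
    using hardy assms(1) unfolding hardy_field_def by blast
  obtain g' where g': "g = germ_of g'"
    by (metis Quotient_abs_rep[OF Quotient_germ])
  have ev: "\<forall>\<^sub>F x in at_top. f x * g' x = 1"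
    using g(2) by (simp add: g' times_germ.abs_eq one_germ.abs_eq germ.abs_eq_iff eventually_equal_def)
  then show "\<forall>\<^sub>F x in at_top. f x \<noteq> 0"
    by eventually_elim auto
  have "eventually_equal g' (\<lambda>x. 1 / f x)"
    unfolding eventually_equal_def using ev
    by eventually_elim (simp add: eq_divide_eq mult.commute, metis mult_zero_left zero_neq_one)
  then show "germ_of (\<lambda>x. 1 / f x) \<in> H"
    using g(1) g' by (metis germ.abs_eq_iff)
qed

text \<open>A nonzero germ is invertible, hence eventually free of zeros; it is also continuous far
  out, so connectedness of a half-line fixes its sign.\<close>

lemma germ_eventually_signed:
  assumes "germ_of f \<in> H"
  shows "eventually_signed f"
proof (cases "\<forall>\<^sub>F x in at_top. f x = 0")
  case True
  then show ?thesis
    unfolding eventually_signed_def by (auto elim: eventually_mono)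
next
  case False
  obtain a where a: "\<And>x. x \<ge> a \<Longrightarrow> f x \<noteq> 0 \<and> (f has_real_derivative deriv f x) (at x)"
    using eventually_conj[OF germ_reciprocal(1)[OF assms False] germ_has_deriv[OF assms]]
    unfolding eventually_at_top_linorder by blast
  have "continuous_on {a..} f"
    by (rule DERIV_continuous_on) (use a in \<open>auto intro: has_field_derivative_at_within\<close>)
  then have conn: "connected (f ` {a..})"
    by (intro connected_continuous_image) auto
  have "0 \<notin> f ` {a..}"
    using a by force
  then have "(\<forall>x\<ge>a. 0 \<le> f x) \<or> (\<forall>x\<ge>a. f x \<le> 0)"
    using connectedD_interval[OF conn] by (metis atLeast_iff image_eqI linorder_linear)
  then show ?thesis
    unfolding eventually_signed_def eventually_at_top_linorder by blast
qed

lemma germ_const_of_nat: "germ_of (\<lambda>x. of_nat n) \<in> H"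
  by (induction n) (use germ_zero germ_one germ_add in auto)

lemma germ_const_of_int: "germ_of (\<lambda>x. of_int n) \<in> H"
  using germ_const_of_nat[of "nat n"] germ_uminus[OF germ_const_of_nat[of "nat (- n)"]]
  by (cases "n \<ge> 0") auto

text \<open>The field axioms guarantee just the constants generated by 1, that is, the rationals.
  This is why the constants \<open>r\<close> in later comparisons with \<open>r / x\<close> are
  rational.\<close>

lemma germ_const_of_rat: "germ_of (\<lambda>x. of_rat r) \<in> H"
proof (cases r)
  case (Fract a b)
  have "germ_of (\<lambda>x. 1 / real_of_int b) \<in> H"
    by (rule germ_reciprocal(2)[OF germ_const_of_int]) (use Fract in auto)
  from germ_mult[OF germ_const_of_int[of a] this] show ?thesis
    using Fract by (simp add: of_rat_rat)
qed

text \<open>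
  The Hardy field need not contain the germ of the identity. Instead of adjoining it, one
  differentiates until the polynomial is constant, which lands back in the field, and then
  integrates the sign information.
\<close>

lemma germ_minus_poly_signed:
  assumes "germ_of f \<in> H" "\<And>i. germ_of (\<lambda>x. coeff p i) \<in> H"
  shows "eventually_signed (\<lambda>x. f x - poly p x)"
  using assms
proof (induction "degree p" arbitrary: p f)
  case 0
  then have "poly p = (\<lambda>x. coeff p 0)"
    by (auto elim!: degree_eq_zeroE)
  then show ?case
    using germ_eventually_signed[OF germ_diff[OF 0(2) 0(3)[of 0]]] by simp
next
  case (Suc n)
  have "germ_of (\<lambda>x. coeff (pderiv p) i) \<in> H" for i
    using germ_mult[OF germ_const_of_nat Suc(4)] by (simp add: coeff_pderiv del: of_nat_Suc)
  moreover have "n = degree (pderiv p)"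
    using Suc(2) by (simp add: degree_pderiv)
  ultimately have "eventually_signed (\<lambda>x. deriv f x - poly (pderiv p) x)"
    using Suc(1) germ_deriv[OF Suc(3)] by blast
  moreover have "\<forall>\<^sub>F x in at_top. ((\<lambda>x. f x - poly p x) has_real_derivative deriv f x - poly (pderiv p) x) (at x)"
    using germ_has_deriv[OF Suc(3)] by eventually_elim (intro DERIV_diff poly_DERIV)
  ultimately show ?case
    by (rule eventually_signed_antideriv[rotated])
qed

text \<open>Differentiating lowers the degree of \<open>p\<close> but turns \<open>c / x ^ m\<close>
  into \<open>- (m * c) / x ^ (m + 1)\<close>, so \<open>f\<close>, \<open>c\<close> and
  \<open>m\<close> all vary in the induction. The application takes \<open>m = 1\<close> and second
  derivatives for \<open>f\<close> and \<open>p\<close>.\<close>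

lemma germ_minus_poly_minus_recip_signed:
  assumes "germ_of f \<in> H" "\<And>i. germ_of (\<lambda>x. coeff p i) \<in> H" "germ_of (\<lambda>x. c) \<in> H"
  shows "eventually_signed (\<lambda>x. f x - poly p x - c / x ^ m)"
  using assms
proof (induction "degree p" arbitrary: p f c m)
  case 0
  define u where "u = (\<lambda>x. f x - coeff p 0)"
  have u: "germ_of u \<in> H"
    unfolding u_def by (rule germ_diff[OF 0(2,3)])
  have p: "poly p = (\<lambda>x. coeff p 0)"
    using 0(1)[symmetric] by (auto elim!: degree_eq_zeroE)
  have pos: "eventually_signed (\<lambda>x. 1 / x ^ m)"
    unfolding eventually_signed_def
    by (rule disjI1, rule eventually_mono[OF eventually_ge_at_top[of 0]]) simp
  have "eventually_signed (\<lambda>x. u x - c / x ^ m)"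
    \<comment> \<open>as \<open>u - c / x\<^sup>m = u * (x\<^sup>m - c / u) / x\<^sup>m\<close>, the polynomial case applies to \<open>c / u\<close>\<close>
  proof (cases "\<forall>\<^sub>F x in at_top. u x = 0")
    case True
    have "eventually_signed (\<lambda>x. - c * (1 / x ^ m))"
      by (rule eventually_signed_mult[OF _ pos]) (auto simp: eventually_signed_def)
    then show ?thesis
      by (rule eventually_signed_cong[rotated]) (use True in \<open>auto elim: eventually_mono\<close>)
  next
    case False
    note r = germ_reciprocal[OF u False]
    have "germ_of (\<lambda>x. coeff (monom 1 m) i) \<in> H" for i
      using germ_zero germ_one by (auto simp: coeff_monom)
    then have "eventually_signed (\<lambda>x. c * (1 / u x) - poly (monom 1 m) x)"
      by (intro germ_minus_poly_signed germ_mult r 0)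
    then have "eventually_signed (\<lambda>x. - (c * (1 / u x) - poly (monom 1 m) x))"
      by (simp only: eventually_signed_uminus)
    then have "eventually_signed (\<lambda>x. u x * (1 / x ^ m * - (c * (1 / u x) - poly (monom 1 m) x)))"
      by (intro eventually_signed_mult[OF germ_eventually_signed[OF u]] eventually_signed_mult[OF pos])
    then show ?thesis
      by (rule eventually_signed_cong[rotated])
        (use r(1) eventually_gt_at_top[of 0] in eventually_elim, simp add: field_simps poly_monom)
  qed
  then show ?case
    by (simp add: u_def p)
next
  case (Suc n)
  have "germ_of (\<lambda>x. coeff (pderiv p) i) \<in> H" for i
    using germ_mult[OF germ_const_of_nat Suc(4)] by (simp add: coeff_pderiv del: of_nat_Suc)
  moreover have "n = degree (pderiv p)"
    using Suc(2) by (simp add: degree_pderiv)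
  moreover have "germ_of (\<lambda>x. - (real m * c)) \<in> H"
    by (rule germ_uminus[OF germ_mult[OF germ_const_of_nat Suc(5)]])
  ultimately have "eventually_signed (\<lambda>x. deriv f x - poly (pderiv p) x - (- (real m * c)) / x ^ Suc m)"
    using Suc(1) germ_deriv[OF Suc(3)] by blast
  moreover have "\<forall>\<^sub>F x in at_top. ((\<lambda>x. f x - poly p x - c / x ^ m) has_real_derivative
     deriv f x - poly (pderiv p) x - (- (real m * c)) / x ^ Suc m) (at x)"
    using germ_has_deriv[OF Suc(3)] eventually_gt_at_top[of 0]
  proof eventually_elim
    case (elim x)
    have "((\<lambda>x. c / x ^ m) has_real_derivative - (real m * c) / x ^ Suc m) (at x)"
      using elim(2)
      by (cases m) (auto intro!: derivative_eq_intros simp: field_simps simp flip: power_Suc power_add)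
    with elim(1) show ?case
      by (intro DERIV_diff poly_DERIV)
  qed
  ultimately show ?case
    by (rule eventually_signed_antideriv[rotated])
qed

end

section \<open>Second-order growth\<close>

text \<open>Integrating \<open>c / x \<le> g'' x\<close> twice bounds \<open>g' x\<close> below by
  \<open>c * ln x - C\<close>, and then \<open>g x\<close> by \<open>c * x * ln x\<close> up to a
  linear error.\<close>

lemma not_smallo_x_ln_x_of_second_deriv_ge:
  fixes g g' g'' :: "real \<Rightarrow> real"
  assumes "\<forall>\<^sub>F x in at_top. (g has_real_derivative g' x) (at x)"
    and "\<forall>\<^sub>F x in at_top. (g' has_real_derivative g'' x) (at x)"
    and "c > 0" "\<forall>\<^sub>F x in at_top. c / x \<le> g'' x"
  shows "\<not> ((\<lambda>x. \<bar>g x\<bar> / (x * ln x)) \<longlongrightarrow> 0) at_top"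
proof
  assume lim: "((\<lambda>x. \<bar>g x\<bar> / (x * ln x)) \<longlongrightarrow> 0) at_top"
  obtain a where a: "a > 1" "\<And>x. x \<ge> a \<Longrightarrow> (g has_real_derivative g' x) (at x)"
      "\<And>x. x \<ge> a \<Longrightarrow> (g' has_real_derivative g'' x) (at x)" "\<And>x. x \<ge> a \<Longrightarrow> c / x \<le> g'' x"
  proof -
    obtain b where "\<forall>x\<ge>b. 1 < x \<and> (g has_real_derivative g' x) (at x) \<and>
        (g' has_real_derivative g'' x) (at x) \<and> c / x \<le> g'' x"
      using eventually_conj[OF eventually_gt_at_top[of 1] eventually_conj[OF assms(1) eventually_conj[OF assms(2,4)]]]
      unfolding eventually_at_top_linorder by blast
    then show ?thesis
      using that[of b] by blast
  qed
  \<comment> \<open>\<open>C\<close> and the later \<open>E\<close> are constants of integration,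
    chosen so that the two lower bounds are equalities at \<open>a\<close>.\<close>
  define C where "C = c * ln a - g' a"
  have g': "c * ln x - C \<le> g' x" if "x \<ge> a" for x
  proof -
    have "g' a - c * ln a \<le> g' x - c * ln x"
    proof (rule DERIV_nonneg_imp_nondecreasing[OF that])
      fix y assume "a \<le> y" "y \<le> x"
      then show "\<exists>D. ((\<lambda>x. g' x - c * ln x) has_real_derivative D) (at y) \<and> 0 \<le> D"
        using a(1) a(3,4)[of y] by (intro exI[of _ "g'' y - c / y"] conjI) (auto intro!: derivative_eq_intros)
    qed
    then show ?thesis by (simp add: C_def)
  qed
  define E where "E = c * (a * ln a - a) - C * a - g a"
  have g: "c * (x * ln x - x) - C * x - E \<le> g x" if "x \<ge> a" for x
  proof -
    have "g a - c * (a * ln a - a) + C * a \<le> g x - c * (x * ln x - x) + C * x"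
    proof (rule DERIV_nonneg_imp_nondecreasing[OF that])
      fix y assume y: "a \<le> y" "y \<le> x"
      then have "((\<lambda>x. g x - c * (x * ln x - x) + C * x) has_real_derivative g' y - c * ln y + C) (at y)"
        using a(1) by (auto intro!: derivative_eq_intros a(2) simp: algebra_simps)
      then show "\<exists>D. ((\<lambda>x. g x - c * (x * ln x - x) + C * x) has_real_derivative D) (at y) \<and> 0 \<le> D"
        using g'[OF y(1)] by (intro exI conjI) auto
    qed
    then show ?thesis by (simp add: E_def)
  qed
  \<comment> \<open>Half of the main term \<open>c * (x * ln x)\<close> survives against
    \<open>\<bar>g x\<bar>\<close>; the threshold on \<open>ln x\<close> makes this half exceed the
    linear error.\<close>
  have "\<forall>\<^sub>F x in at_top. \<bar>g x\<bar> / (x * ln x) < c / 2"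
    using order_tendstoD(2)[OF lim, of "c / 2"] assms(3) by simp
  moreover have "\<forall>\<^sub>F x in at_top. 2 * (\<bar>c + C\<bar> + \<bar>E\<bar>) / c < ln x"
    using ln_at_top unfolding filterlim_at_top_dense by blast
  ultimately have "\<forall>\<^sub>F x::real in at_top. False"
    using eventually_ge_at_top[of a]
  proof eventually_elim
    case (elim x)
    have x: "x > 1" "ln x > 0" using a(1) elim(3) by auto
    have "\<bar>g x\<bar> < c / 2 * (x * ln x)"
      using elim(1) x by (simp add: pos_divide_less_eq)
    then have 1: "c / 2 * (x * ln x) < (c + C) * x + E"
      using g[OF elim(3)] by (simp add: algebra_simps)
    have "(c + C) * x \<le> \<bar>c + C\<bar> * x" "E \<le> \<bar>E\<bar> * x"
      using x mult_left_mono[of 1 x "\<bar>E\<bar>"] by (auto intro: mult_right_mono)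
    moreover have "(\<bar>c + C\<bar> + \<bar>E\<bar>) * x \<le> (c / 2 * ln x) * x"
      using elim(2) x assms(3) by (intro mult_right_mono) (auto simp: field_simps)
    ultimately show ?case
      using 1 by (simp add: algebra_simps)
  qed
  then show False by simp
qed

text \<open>For rational \<open>r\<close> between 0 and \<epsilon>, \<open>g'' x - r / x\<close> has
  an eventual sign. Were it nonnegative, \<open>g\<close> would be too large, so it is nonpositive;
  the same argument for \<open>- g\<close> gives the lower bound.\<close>

lemma second_deriv_smallo_inverse:
  fixes g g' g'' :: "real \<Rightarrow> real"
  assumes g: "\<forall>\<^sub>F x in at_top. (g has_real_derivative g' x) (at x)"
    and g': "\<forall>\<^sub>F x in at_top. (g' has_real_derivative g'' x) (at x)"
    and signed: "\<And>r :: rat. (\<forall>\<^sub>F x in at_top. 0 \<le> g'' x - of_rat r / x) \<or> (\<forall>\<^sub>F x in at_top. g'' x - of_rat r / x \<le> 0)"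
    and lim: "((\<lambda>x. \<bar>g x\<bar> / (x * ln x)) \<longlongrightarrow> 0) at_top"
    and "\<epsilon> > 0"
  shows "\<forall>\<^sub>F x in at_top. \<bar>g'' x\<bar> \<le> \<epsilon> / x"
proof -
  obtain r :: rat where r: "0 < real_of_rat r" "of_rat r < \<epsilon>"
    using of_rat_dense[OF \<open>\<epsilon> > 0\<close>] by blast
  have "\<not> (\<forall>\<^sub>F x in at_top. 0 \<le> g'' x - of_rat r / x)"
    using not_smallo_x_ln_x_of_second_deriv_ge[OF g g' r(1)] lim by auto
  then have "\<forall>\<^sub>F x in at_top. g'' x - of_rat r / x \<le> 0"
    using signed by blast
  moreover have "\<not> (\<forall>\<^sub>F x in at_top. g'' x - of_rat (- r) / x \<le> 0)"
  proof
    assume "\<forall>\<^sub>F x in at_top. g'' x - of_rat (- r) / x \<le> 0"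
    then have ge: "\<forall>\<^sub>F x in at_top. of_rat r / x \<le> - g'' x"
      by eventually_elim (simp add: of_rat_minus)
    have mg: "\<forall>\<^sub>F x in at_top. ((\<lambda>x. - g x) has_real_derivative - g' x) (at x)"
      using g by eventually_elim (rule DERIV_minus)
    have mg': "\<forall>\<^sub>F x in at_top. ((\<lambda>x. - g' x) has_real_derivative - g'' x) (at x)"
      using g' by eventually_elim (rule DERIV_minus)
    show False
      using not_smallo_x_ln_x_of_second_deriv_ge[OF mg mg' r(1) ge] lim by simp
  qed
  then have "\<forall>\<^sub>F x in at_top. 0 \<le> g'' x - of_rat (- r) / x"
    using signed by blast
  ultimately show ?thesis
    using eventually_gt_at_top[of 0]
  proof eventually_elim
    case (elim x)
    have "of_rat r / x \<le> \<epsilon> / x"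
      using r elim(3) by (intro divide_right_mono) auto
    then show ?case
      using elim by (simp add: of_rat_minus)
  qed
qed

text \<open>If \<open>g'\<close> missed the set \<theta> + \<int>, connectedness would trap it
  between two consecutive points of that set. Then \<open>g\<close> would be Lipschitz, against its
  superlinear growth.\<close>

lemma superlinear_deriv_hits_residue:
  fixes g g' :: "real \<Rightarrow> real"
  assumes deriv: "\<And>x. x \<ge> b \<Longrightarrow> (g has_real_derivative g' x) (at x)"
    and cont: "continuous_on {b..} g'"
    and lim: "filterlim (\<lambda>x. \<bar>g x\<bar> / x) at_top at_top"
  shows "\<exists>x\<ge>b. g' x - \<theta> \<in> \<int>"
proof (rule ccontr)
  assume *: "\<not> (\<exists>x\<ge>b. g' x - \<theta> \<in> \<int>)"
  \<comment> \<open>The largest point of \<theta> + \<int> not exceeding \<open>g' b\<close>, so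
    that \<open>k\<close> and \<open>k + 1\<close> are the two barriers.\<close>
  define k where "k = of_int \<lfloor>g' b - \<theta>\<rfloor> + \<theta>"
  have conn: "connected (g' ` {b..})"
    by (intro connected_continuous_image cont) auto
  have "of_int i + \<theta> \<notin> g' ` {b..}" for i
  proof
    assume "of_int i + \<theta> \<in> g' ` {b..}"
    then obtain x where "x \<ge> b" "g' x - \<theta> = of_int i" by force
    then show False using * by (metis Ints_of_int)
  qed
  from this[of "\<lfloor>g' b - \<theta>\<rfloor>"] this[of "\<lfloor>g' b - \<theta>\<rfloor> + 1"]
  have notin: "k \<notin> g' ` {b..}" "k + 1 \<notin> g' ` {b..}"
    by (simp_all add: k_def add.commute add.left_commute)
  have kb: "k \<le> g' b" "g' b \<le> k + 1"
    unfolding k_def by linarith+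
  have bound: "k \<le> g' x" "g' x \<le> k + 1" if "x \<ge> b" for x
  proof -
    have "g' x \<in> g' ` {b..}" "g' b \<in> g' ` {b..}"
      using that by auto
    then show "k \<le> g' x" "g' x \<le> k + 1"
      using connectedD_interval[OF conn] notin kb by (meson linorder_linear)+
  qed
  define M where "M = \<bar>k\<bar> + 1"
  have M: "\<bar>g x - g b\<bar> \<le> M * (x - b)" if x: "x \<ge> b" for x
  proof -
    have "M * b - g b \<le> M * x - g x"
    proof (rule DERIV_nonneg_imp_nondecreasing[OF x])
      fix y assume y: "b \<le> y" "y \<le> x"
      have "((\<lambda>x. M * x - g x) has_real_derivative M - g' y) (at y)"
        using deriv[OF y(1)] by (auto intro!: derivative_eq_intros)
      then show "\<exists>D. ((\<lambda>x. M * x - g x) has_real_derivative D) (at y) \<and> 0 \<le> D"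
        using bound[OF y(1)] by (intro exI conjI) (auto simp: M_def)
    qed
    moreover have "M * b + g b \<le> M * x + g x"
    proof (rule DERIV_nonneg_imp_nondecreasing[OF x])
      fix y assume y: "b \<le> y" "y \<le> x"
      have "((\<lambda>x. M * x + g x) has_real_derivative M + g' y) (at y)"
        using deriv[OF y(1)] by (auto intro!: derivative_eq_intros)
      then show "\<exists>D. ((\<lambda>x. M * x + g x) has_real_derivative D) (at y) \<and> 0 \<le> D"
        using bound[OF y(1)] by (intro exI conjI) (auto simp: M_def)
    qed
    ultimately show ?thesis
      by (simp add: algebra_simps abs_le_iff)
  qed
  \<comment> \<open>The Lipschitz bound is
    \<open>\<bar>g b\<bar> + M * x + M * \<bar>b\<bar>\<close>, which for \<open>x \<ge> 1\<close>
    is at most this threshold times \<open>x\<close>.\<close>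
  have "\<forall>\<^sub>F x in at_top. \<bar>g b\<bar> + M + M * \<bar>b\<bar> < \<bar>g x\<bar> / x"
    using lim unfolding filterlim_at_top_dense by blast
  then have "\<forall>\<^sub>F x::real in at_top. False"
    using eventually_ge_at_top[of b] eventually_ge_at_top[of 1]
  proof eventually_elim
    case (elim x)
    have "(\<bar>g b\<bar> + M + M * \<bar>b\<bar>) * x < \<bar>g x\<bar>"
      using elim(1,3) by (simp add: pos_less_divide_eq)
    moreover have "\<bar>g x\<bar> \<le> \<bar>g b\<bar> + M * x + M * \<bar>b\<bar>"
    proof -
      have "M * (x - b) \<le> M * (x + \<bar>b\<bar>)"
        by (intro mult_left_mono) (auto simp: M_def)
      then show ?thesis
        using M[OF elim(2)] by (simp add: algebra_simps)
    qed
    moreover have "\<bar>g b\<bar> \<le> \<bar>g b\<bar> * x" "M * \<bar>b\<bar> \<le> M * \<bar>b\<bar> * x"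
      using mult_left_mono[OF elim(3), of "\<bar>g b\<bar>"] mult_left_mono[OF elim(3), of "M * \<bar>b\<bar>"]
      by (simp_all add: M_def)
    ultimately show ?case
      by (simp add: algebra_simps)
  qed
  then show False by simp
qed

text \<open>Taylor's formula on the convex set \<open>{b..}\<close>, so \<open>y\<close> may lie on
  either side of \<open>x\<close>. The usual factor 1/2 in the remainder is given up, since just its
  order matters.\<close>

lemma second_order_Taylor_bound:
  fixes g g' g'' :: "real \<Rightarrow> real"
  assumes "\<And>y. y \<ge> b \<Longrightarrow> (g has_real_derivative g' y) (at y)"
    and "\<And>y. y \<ge> b \<Longrightarrow> (g' has_real_derivative g'' y) (at y)"
    and "\<And>y. y \<ge> b \<Longrightarrow> \<bar>g'' y\<bar> \<le> K"
    and "x \<ge> b" "y \<ge> b"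
  shows "\<bar>g y - (g x + (y - x) * g' x)\<bar> \<le> K * (y - x)\<^sup>2"
proof -
  define f where "f i = (if i = 0 then g else if i = 1 then g' else g'')" for i :: nat
  have "norm (f 0 y - (\<Sum>i\<le>1. f i x * (y - x) ^ i / fact i)) \<le> K * norm (y - x) ^ Suc 1 / fact 1"
  proof (rule field_Taylor)
    fix i z assume "z \<in> {b..}" "i \<le> (1::nat)"
    then show "(f i has_field_derivative f (Suc i) z) (at z within {b..})"
      using assms(1,2) by (auto simp: f_def intro: has_field_derivative_at_within)
  qed (use assms in \<open>auto simp: f_def\<close>)
  then show ?thesis
    by (simp add: f_def mult.commute power2_eq_square)
qed

section \<open>Chords and periods on the unit circle\<close>

lemma norm_cis_diff_le: "norm (cis s - cis t) \<le> \<bar>s - t\<bar>"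
proof -
  have "cis s - cis t = cis t * (cis (s - t) - 1)"
    by (simp add: algebra_simps cis_mult)
  then have "norm (cis s - cis t) = 2 * \<bar>sin ((s - t) / 2)\<bar>"
    using dist_exp_i_1[of "s - t"] by (simp add: norm_mult cis_conv_exp)
  also have "\<dots> \<le> \<bar>s - t\<bar>"
    using abs_sin_x_le_abs_x[of "(s - t) / 2"] by simp
  finally show ?thesis .
qed

lemma cis_2pi_eq_1_iff: "cis (2 * pi * t) = 1 \<longleftrightarrow> t \<in> \<int>"
proof
  assume "cis (2 * pi * t) = 1"
  then have "cos (2 * pi * t) = 1"
    by (simp add: complex_eq_iff)
  then obtain n :: int where "2 * pi * t = of_int n * 2 * pi"
    using cos_one_2pi_int by blast
  then show "t \<in> \<int>" by simp
qed simp

section \<open>Binomial averages\<close>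

text \<open>This is the variance \<open>N / 4\<close> of a binomial variable with parameter 1/2,
  before normalisation; it is read off from the moments of the Bernstein polynomials at 1/2.\<close>

lemma binomial_variance:
  "(\<Sum>n\<le>N. real (N choose n) * (real n - real N / 2)\<^sup>2) = 2 ^ N * (real N / 4)"
proof -
  have B: "Bernstein N n (1/2) = real (N choose n) / 2 ^ N" if "n \<le> N" for n
    using that by (simp add: Bernstein_def power_one_over flip: power_add divide_divide_eq_left)
      (simp add: field_simps flip: power_add)
  have "(\<Sum>n\<le>N. real (N choose n) * (real n - real N / 2)\<^sup>2) / 2 ^ N
      = (\<Sum>n\<le>N. (real n - real N / 2)\<^sup>2 * Bernstein N n (1/2))"
    unfolding sum_divide_distrib by (intro sum.cong) (auto simp: B)
  \<comment> \<open>Expands the square as \<open>n * (n - 1) + (1 - N) * n + (N / 2)^2\<close> to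
    match the known factorial moments.\<close>
  also have "\<dots> = (\<Sum>n\<le>N. real n * (real n - 1) * Bernstein N n (1/2))
      + (1 - real N) * (\<Sum>n\<le>N. real n * Bernstein N n (1/2))
      + (real N / 2)\<^sup>2 * (\<Sum>n\<le>N. Bernstein N n (1/2))"
    unfolding sum_distrib_left sum.distrib[symmetric]
    by (intro sum.cong) (auto simp: algebra_simps power2_eq_square)
  also have "\<dots> = real N / 4"
    unfolding sum_kk_Bernstein sum_k_Bernstein sum_Bernstein
    by (simp add: field_simps power2_eq_square)
  finally show ?thesis
    by (simp add: field_simps)
qed

text \<open>A quadratic majorant centred at \<open>N / 2\<close> averages to \<open>A\<close> plus
  \<open>B\<close> times the variance. This takes the place of a tail estimate for the binomial
  weights.\<close>

lemma norm_binomial_average_le: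
  assumes "\<And>n. n \<le> N \<Longrightarrow> norm (a n) \<le> A + B * (real n - real N / 2)\<^sup>2"
  shows "norm (binomial_average a N) \<le> A + B * real N / 4"
proof -
  let ?b = "\<lambda>n. real (N choose n) * (A + B * (real n - real N / 2)\<^sup>2)"
  have b: "norm (of_nat (N choose n) * a n) \<le> ?b n" if "n \<le> N" for n
    using assms[OF that] by (simp add: norm_mult mult_left_mono)
  have "norm (\<Sum>n=1..N. of_nat (N choose n) * a n) \<le> (\<Sum>n=1..N. ?b n)"
    using b by (intro sum_norm_le) auto
  \<comment> \<open>The term \<open>n = 0\<close>, absent from the average, can be added because the
    majorant dominates a norm and so is nonnegative.\<close>
  also have "\<dots> \<le> (\<Sum>n\<le>N. ?b n)"
    by (rule sum_mono2) (auto intro: order_trans[OF norm_ge_zero b])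
  also have "\<dots> = A * (\<Sum>n\<le>N. real (N choose n)) + B * (\<Sum>n\<le>N. real (N choose n) * (real n - real N / 2)\<^sup>2)"
    by (simp add: sum_distrib_left sum.distrib algebra_simps)
  also have "\<dots> = 2 ^ N * (A + B * real N / 4)"
    using choose_row_sum[of N]
    by (simp add: binomial_variance algebra_simps flip: of_nat_sum)
  finally show ?thesis
    by (simp add: binomial_average_def norm_mult norm_divide norm_power pos_divide_le_eq mult.commute)
qed

text \<open>The binomial theorem; the subtracted power of 1/2 is the missing term
  \<open>n = 0\<close>.\<close>

lemma binomial_average_power:
  "binomial_average (\<lambda>n. z ^ n) N = ((1 + z) / 2) ^ N - (1 / 2) ^ N"
proof -
  have "(1 + z) ^ N = (\<Sum>n\<le>N. of_nat (N choose n) * z ^ n)"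
    using binomial_ring[of z 1 N] by (simp add: add.commute)
  also have "\<dots> = 1 + (\<Sum>n=1..N. of_nat (N choose n) * z ^ n)"
    by (simp add: sum.atMost_shift sum.atLeast1_atMost_eq lessThan_Suc_atMost)
  finally show ?thesis
    by (simp add: binomial_average_def power_divide field_simps)
qed

text \<open>For \<open>z \<noteq> 1\<close> on the unit circle the midpoint
  \<open>(1 + z) / 2\<close> lies strictly inside the disc, so its powers tend to 0.\<close>

lemma binomial_average_power_tendsto:
  assumes "norm z = 1"
  shows "binomial_average (\<lambda>n. z ^ n) \<longlonglongrightarrow> (if z = 1 then 1 else 0)"
proof -
  have half: "(\<lambda>N. (1 / 2 :: complex) ^ N) \<longlonglongrightarrow> 0"
    by (rule LIMSEQ_power_zero) (simp add: norm_divide)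
  have "(\<lambda>N. ((1 + z) / 2) ^ N) \<longlonglongrightarrow> (if z = 1 then 1 else 0)"
  proof (cases "z = 1")
    case False
    have "Re z \<noteq> 1"
      using False assms by (auto simp: complex_eq_iff cmod_def)
    moreover have "Re z \<le> 1"
      using complex_Re_le_cmod[of z] assms by simp
    moreover have "(Re z)\<^sup>2 + (Im z)\<^sup>2 = 1"
      using cmod_power2[of z] assms by simp
    ultimately have "(norm (1 + z))\<^sup>2 < 2\<^sup>2"
      unfolding cmod_power2 by (simp add: power2_sum)
    then have "norm (1 + z) < 2"
      by (rule power2_less_imp_less) simp
    then show ?thesis
      using False by (auto intro!: LIMSEQ_power_zero simp: norm_divide)
  qed simp
  from tendsto_diff[OF this half] show ?thesis
    by (simp add: binomial_average_power[abs_def])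
qed

text \<open>Serves to extract a single Fourier coefficient: after a twist, the one frequency that
  becomes trivial survives in the limit.\<close>

lemma binomial_average_sum_powers_tendsto:
  assumes "finite J" "\<And>j. j \<in> J \<Longrightarrow> norm (z j) = 1"
  shows "binomial_average (\<lambda>n. \<Sum>j\<in>J. c j * z j ^ n) \<longlonglongrightarrow> (\<Sum>j\<in>J. c j * (if z j = 1 then 1 else 0))"
proof -
  have "binomial_average (\<lambda>n. \<Sum>j\<in>J. c j * z j ^ n) N = (\<Sum>j\<in>J. c j * binomial_average (\<lambda>n. z j ^ n) N)" for N
    unfolding binomial_average_def sum_distrib_left
    by (subst sum.swap) (simp add: mult_ac)
  moreover have "(\<lambda>N. \<Sum>j\<in>J. c j * binomial_average (\<lambda>n. z j ^ n) N) \<longlonglongrightarrow> (\<Sum>j\<in>J. c j * (if z j = 1 then 1 else 0))"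
    by (intro tendsto_sum tendsto_mult tendsto_const binomial_average_power_tendsto assms)
  ultimately show ?thesis by presburger
qed

section \<open>Periodicity of rational polynomials modulo 1\<close>

text \<open>Fourier inversion on the integers modulo \<open>D\<close>, resting on the orthogonality
  of the characters.\<close>

lemma discrete_Fourier_expansion:
  fixes f :: "nat \<Rightarrow> complex"
  assumes "D > 0" "\<And>n. f (n + D) = f n"
  shows "\<exists>c. \<forall>n. f n = (\<Sum>j<D. c j * cis (2 * pi * (real j / real D)) ^ n)"
proof (intro exI allI)
  fix n
  \<comment> \<open>The usual Fourier coefficients. They are defined after \<open>n\<close> is fixed
    but do not depend on it, so they witness the existential.\<close>
  define c where "c j = (\<Sum>m<D. f m * cis (- (2 * pi * (real j * real m / real D)))) / of_nat D" for j
  have orth: "(\<Sum>j<D. cis (2 * pi * ((real n - real m) / real D)) ^ j) = (if m = n mod D then of_nat D else 0)"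
    if "m < D" for m
  proof -
    define w where "w = cis (2 * pi * ((real n - real m) / real D))"
    have "w ^ D = 1"
    proof -
      have "real D * (2 * pi * ((real n - real m) / real D)) = 2 * pi * (real n - real m)"
        using assms(1) by simp
      then have "w ^ D = cis (2 * pi * (real n - real m))"
        unfolding w_def Complex.DeMoivre by (rule arg_cong)
      then show ?thesis
        by (metis Ints_diff Ints_of_nat cis_multiple_2pi)
    qed
    then have "w \<noteq> 1 \<Longrightarrow> (\<Sum>j<D. w ^ j) = 0"
      by (simp add: geometric_sum)
    moreover have "w = 1 \<longleftrightarrow> m = n mod D"
    proof -
      have "w = 1 \<longleftrightarrow> real_of_int (int n - int m) / real_of_int (int D) \<in> \<int>"
        unfolding w_def cis_2pi_eq_1_iff by simp
      also have "\<dots> \<longleftrightarrow> int D dvd int n - int m"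
        using assms(1) by (subst of_int_div_of_int_in_Ints_iff) auto
      also have "\<dots> \<longleftrightarrow> int n mod int D = int m mod int D"
        by (simp add: mod_eq_dvd_iff)
      also have "\<dots> \<longleftrightarrow> m = n mod D"
        using that by (metis mod_less of_nat_eq_iff of_nat_mod)
      finally show ?thesis .
    qed
    ultimately show ?thesis
      unfolding w_def[symmetric] by auto
  qed
  have per: "f (m + k * D) = f m" for m k
  proof (induction k)
    case (Suc k)
    have "f (m + Suc k * D) = f ((m + k * D) + D)"
      by (simp add: add_ac)
    then show ?case
      using Suc assms(2) by presburger
  qed simp
  have "(\<Sum>j<D. c j * cis (2 * pi * (real j / real D)) ^ n)
      = (\<Sum>j<D. \<Sum>m<D. f m / of_nat D * cis (2 * pi * ((real n - real m) / real D)) ^ j)"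
    unfolding c_def sum_divide_distrib sum_distrib_right
    by (intro sum.cong refl) (simp add: Complex.DeMoivre cis_mult field_simps)
  also have "\<dots> = (\<Sum>m<D. f m / of_nat D * (\<Sum>j<D. cis (2 * pi * ((real n - real m) / real D)) ^ j))"
    by (subst sum.swap) (simp add: sum_distrib_left)
  also have "\<dots> = (\<Sum>m<D. if m = n mod D then f m else 0)"
    using assms(1) by (intro sum.cong refl, subst orth) auto
  also have "\<dots> = f (n mod D)"
    using assms(1) by simp
  also have "\<dots> = f n"
    using per[of "n mod D" "n div D"] by simp
  finally show "f n = (\<Sum>j<D. c j * cis (2 * pi * (real j / real D)) ^ n)" by simp
qed

lemma rat_poly_eval_pCons [simp]:
  "rat_poly_eval (pCons a p) x = of_rat a + x * rat_poly_eval p x"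
  by (simp add: rat_poly_eval_def map_poly_pCons)

text \<open>The witness is a product of denominators of the coefficients, built up along
  \<open>pCons\<close>.\<close>

lemma rat_poly_common_denominator:
  fixes p :: "rat poly"
  shows "\<exists>D>0. \<forall>i. real D * of_rat (coeff p i) \<in> \<int>"
proof (induction p)
  case 0
  then show ?case by (auto intro: exI[of _ 1])
next
  case (pCons a p)
  then obtain D where D: "D > 0" "\<And>i. real D * of_rat (coeff p i) \<in> \<int>" by blast
  obtain u v where a: "a = Fract u v" "v > 0" by (cases a) blast
  have "real (nat v * D) * of_rat (coeff (pCons a p) i) \<in> \<int>" for i
  proof (cases i)
    case 0
    then have "real (nat v * D) * of_rat (coeff (pCons a p) i) = of_int (int D * u)"
      using a by (simp add: of_rat_rat)
    then show ?thesis by (metis Ints_of_int)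
  next
    case (Suc j)
    then show ?thesis
      using Ints_mult[OF Ints_of_nat D(2)[of j], of "nat v"] by (simp add: mult.assoc)
  qed
  then show ?case
    using D(1) a(2) by (intro exI[of _ "nat v * D"]) auto
qed

text \<open>Both claims are proved together: the shift by \<open>D\<close> of \<open>x * p x\<close>
  produces the extra term \<open>D * p (n + D)\<close>, which is an integer by the first claim for
  \<open>p\<close>.\<close>

lemma rat_poly_eval_periodic_mod_1:
  fixes p :: "rat poly"
  assumes "\<And>i. real D * of_rat (coeff p i) \<in> \<int>"
  shows "real D * rat_poly_eval p (real n) \<in> \<int>"
    and "rat_poly_eval p (real (n + D)) - rat_poly_eval p (real n) \<in> \<int>"
proof -
  have "real D * rat_poly_eval p (real n) \<in> \<int> \<and>
      rat_poly_eval p (real (n + D)) - rat_poly_eval p (real n) \<in> \<int>" for n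
    using assms
  proof (induction p arbitrary: n)
    case 0
    then show ?case by (simp add: rat_poly_eval_def)
  next
    case (pCons a p)
    have a: "real D * of_rat a \<in> \<int>"
      using pCons.prems[of 0] by simp
    have p: "real D * rat_poly_eval p (real m) \<in> \<int>"
        "rat_poly_eval p (real (m + D)) - rat_poly_eval p (real m) \<in> \<int>" for m
      using pCons.IH pCons.prems[of "Suc _"] by auto
    have "real D * of_rat a + real n * (real D * rat_poly_eval p (real n)) \<in> \<int>"
      by (intro Ints_add Ints_mult a p) auto
    moreover have "real n * (rat_poly_eval p (real (n + D)) - rat_poly_eval p (real n))
        + real D * rat_poly_eval p (real (n + D)) \<in> \<int>"
      by (intro Ints_add Ints_mult p) auto
    ultimately show ?case
      by (simp add: algebra_simps)
  qed
  then show "real D * rat_poly_eval p (real n) \<in> \<int>"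
    and "rat_poly_eval p (real (n + D)) - rat_poly_eval p (real n) \<in> \<int>"
    by blast+
qed

section \<open>Comparison with a periodic sequence\<close>

text \<open>Near \<open>x\<close> the function \<open>g\<close> is replaced by its tangent, whose
  slope is \<open>- \<kappa>\<close> modulo 1, so at integers just a constant phase remains beside
  the twist. The Taylor error of order \<open>\<epsilon> / N * (n - x)^2\<close> averages to order
  \<epsilon> because the variance is \<open>N / 4\<close>; small \<open>n\<close> contribute
  \<open>8 / N\<close>.\<close>

lemma binomial_average_linearization:
  fixes g g' g'' :: "real \<Rightarrow> real" and q :: "nat \<Rightarrow> real"
  assumes deriv: "\<And>y. y \<ge> b \<Longrightarrow> (g has_real_derivative g' y) (at y)"
      "\<And>y. y \<ge> b \<Longrightarrow> (g' has_real_derivative g'' y) (at y)"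
    and bound: "\<And>y. y \<ge> b \<Longrightarrow> \<bar>g'' y\<bar> \<le> \<epsilon> / y"
    and "b > 0" "\<epsilon> > 0" "x \<ge> 2 * b + 1" and residue: "g' x + \<kappa> \<in> \<int>"
    and N: "N = nat \<lfloor>2 * x\<rfloor>"
  shows "norm (binomial_average (\<lambda>n. cis (2 * pi * (q n + g (real n)))) N
      - cis (2 * pi * (g x - x * g' x)) * binomial_average (\<lambda>n. cis (2 * pi * (q n - \<kappa> * real n))) N)
    \<le> 8 * pi * \<epsilon> + 8 / real N"
proof -
  have x: "real N \<le> 2 * x" "2 * x - 1 < real N"
    using assms(4,6) unfolding N by linarith+
  \<comment> \<open>\<open>x \<ge> 2 * b + 1\<close> gives \<open>N > 4 * b + 1\<close>. Hence every
    point from \<open>N / 4\<close> on lies in the range where the bounds on \<open>g\<close>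
    hold.\<close>
  then have N4: "real N / 4 \<ge> b" "real N \<ge> 1" "x \<ge> real N / 4"
    using assms(4,6) by linarith+
  let ?\<gamma> = "g x - x * g' x"
  let ?d = "\<lambda>n. cis (2 * pi * (q n + g (real n))) - cis (2 * pi * ?\<gamma>) * cis (2 * pi * (q n - \<kappa> * real n))"
  \<comment> \<open>\<open>A\<close> absorbs the rounding error between \<open>x\<close> and
    \<open>N / 2\<close>. In \<open>B\<close>, the first summand comes from the Taylor remainder and
    the second from the trivial bound 2 where \<open>n < N / 4\<close>.\<close>
  define A where "A = 4 * pi * \<epsilon> / real N"
  define B where "B = 16 * pi * \<epsilon> / real N + 32 / (real N)\<^sup>2"
  have "norm (?d n) \<le> A + B * (real n - real N / 2)\<^sup>2" for n
  proof (cases "real n \<ge> real N / 4")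
    case True
    have K: "\<bar>g'' y\<bar> \<le> 4 * \<epsilon> / real N" if "y \<ge> real N / 4" for y
    proof -
      have "\<epsilon> / y \<le> \<epsilon> / (real N / 4)"
        using that N4(2) assms(5) by (intro divide_left_mono) auto
      then show ?thesis
        using bound[of y] that N4(1) by (simp add: mult.commute)
    qed
    define R where "R = g (real n) - (g x + (real n - x) * g' x)"
    have R: "\<bar>R\<bar> \<le> 4 * \<epsilon> / real N * (real n - x)\<^sup>2"
      unfolding R_def using N4 True
      by (intro second_order_Taylor_bound[where b = "real N / 4" and g'' = g''] deriv K) auto
    \<comment> \<open>This trivial factor trades the frequency \<open>- \<kappa>\<close> for the
      slope \<open>g' x\<close>, so that the two phases differ by \<open>R\<close> alone.\<close>
    have "cis (2 * pi * ((g' x + \<kappa>) * real n)) = 1"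
      using residue by (subst cis_2pi_eq_1_iff) (auto intro: Ints_mult)
    then have "cis (2 * pi * ?\<gamma>) * cis (2 * pi * (q n - \<kappa> * real n))
        = cis (2 * pi * ?\<gamma>) * cis (2 * pi * (q n - \<kappa> * real n)) * cis (2 * pi * ((g' x + \<kappa>) * real n))"
      by simp
    also have "\<dots> = cis (2 * pi * (q n + g (real n) - R))"
      unfolding cis_mult R_def by (rule arg_cong[of _ _ cis]) (simp add: algebra_simps)
    finally have "norm (?d n) \<le> \<bar>2 * pi * (q n + g (real n)) - 2 * pi * (q n + g (real n) - R)\<bar>"
      using norm_cis_diff_le by presburger
    also have "\<dots> = 2 * pi * \<bar>R\<bar>"
      by (simp add: algebra_simps abs_mult)
    \<comment> \<open>Recentres the square from \<open>x\<close> to \<open>N / 2\<close>, which are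
      at most 1/2 apart because \<open>N\<close> is the integer part of
      \<open>2 * x\<close>.\<close>
    also have "\<dots> \<le> 2 * pi * (4 * \<epsilon> / real N * (2 * (real n - real N / 2)\<^sup>2 + 1 / 2))"
    proof -
      have "(real N / 2 - x)\<^sup>2 \<le> (1 / 2)\<^sup>2"
        using x by (intro power2_le_iff_abs_le[THEN iffD2]) auto
      moreover have "(real n - x)\<^sup>2 \<le> 2 * (real n - real N / 2)\<^sup>2 + 2 * (real N / 2 - x)\<^sup>2"
        using zero_le_power2[of "(real n - real N / 2) - (real N / 2 - x)"]
        by (simp add: power2_eq_square algebra_simps)
      ultimately have "(real n - x)\<^sup>2 \<le> 2 * (real n - real N / 2)\<^sup>2 + 1 / 2"
        by (simp add: power2_eq_square)
      then have "4 * \<epsilon> / real N * (real n - x)\<^sup>2 \<le> 4 * \<epsilon> / real N * (2 * (real n - real N / 2)\<^sup>2 + 1 / 2)"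
        using assms(5) by (intro mult_left_mono) auto
      then show ?thesis
        using R by (intro mult_left_mono) auto
    qed
    also have "\<dots> = A + 16 * pi * \<epsilon> / real N * (real n - real N / 2)\<^sup>2"
      using N4(2) by (simp add: A_def field_simps)
    also have "\<dots> \<le> A + B * (real n - real N / 2)\<^sup>2"
      unfolding B_def by (intro add_left_mono mult_right_mono) auto
    finally show ?thesis .
  next
    case False
    \<comment> \<open>the trivial bound, made quadratic so that the variance absorbs it\<close>
    have "norm (?d n) \<le> 2"
      by (rule order_trans[OF norm_triangle_ineq4]) (simp add: norm_mult)
    also have "2 = 32 / (real N)\<^sup>2 * (real N / 4)\<^sup>2"
      using N4(2) by (simp add: power2_eq_square)
    also have "\<dots> \<le> 32 / (real N)\<^sup>2 * (real n - real N / 2)\<^sup>2"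
      using False by (intro mult_left_mono abs_le_square_iff[THEN iffD1]) auto
    also have "\<dots> \<le> A + B * (real n - real N / 2)\<^sup>2"
      using assms(5) by (simp add: A_def B_def distrib_right)
    finally show ?thesis .
  qed
  then have "norm (binomial_average ?d N) \<le> A + B * real N / 4"
    by (rule norm_binomial_average_le)
  also have "\<dots> = 4 * pi * \<epsilon> / real N + 4 * pi * \<epsilon> + 8 / real N"
    using N4(2) by (simp add: A_def B_def field_simps power2_eq_square)
  also have "\<dots> \<le> 8 * pi * \<epsilon> + 8 / real N"
    using N4(2) assms(5) divide_left_mono[of 1 "real N" "4 * pi * \<epsilon>"] by simp
  finally show ?thesis
    by (simp add: binomial_average_def sum_subtractf sum_distrib_left algebra_simps)
qed

theorem theorem5p12:
  fixes h :: "real \<Rightarrow> real" and H :: "germ set"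
  assumes "hardy_field H" and "germ_of h \<in> H"
    and "polynomial_growth h"
    and "\<And>p :: rat poly. filterlim (\<lambda>x. \<bar>h x - rat_poly_eval p x\<bar> / x) at_top at_top"
    and "\<exists>q :: rat poly. ((\<lambda>x. \<bar>h x - rat_poly_eval q x\<bar> / (x * ln x)) \<longlongrightarrow> 0) at_top"
  shows "\<not> (\<lambda>N. binomial_average (\<lambda>n. exp (2 * of_real pi * \<i> * of_real (h (real n)))) N) \<longlonglongrightarrow> 0"
proof
  assume "(\<lambda>N. binomial_average (\<lambda>n. exp (2 * of_real pi * \<i> * of_real (h (real n)))) N) \<longlonglongrightarrow> 0"
  then have lim: "binomial_average (\<lambda>n. cis (2 * pi * h (real n))) \<longlonglongrightarrow> 0"
    by (simp add: cis_conv_exp mult_ac)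
  obtain q :: "rat poly" where q: "((\<lambda>x. \<bar>h x - rat_poly_eval q x\<bar> / (x * ln x)) \<longlongrightarrow> 0) at_top"
    using assms(5) by blast
  define Q :: "real poly" where "Q = map_poly of_rat q"
  define g where "g x = h x - rat_poly_eval q x" for x
  define g' where "g' x = deriv h x - poly (pderiv Q) x" for x
  define g'' where "g'' x = deriv (deriv h) x - poly (pderiv (pderiv Q)) x" for x
  note h' = germ_deriv[OF assms(1,2)]
  have g': "\<forall>\<^sub>F x in at_top. (g has_real_derivative g' x) (at x)"
    using germ_has_deriv[OF assms(1,2)] unfolding g_def[abs_def] g'_def rat_poly_eval_def Q_def[symmetric]
    by eventually_elim (intro DERIV_diff poly_DERIV)
  have g'': "\<forall>\<^sub>F x in at_top. (g' has_real_derivative g'' x) (at x)"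
    using germ_has_deriv[OF assms(1) h'] unfolding g'_def[abs_def] g''_def
    by eventually_elim (intro DERIV_diff poly_DERIV)
  \<comment> \<open>The coefficients stay rational under differentiation, hence their constant germs
    lie in \<open>H\<close>.\<close>
  have "germ_of (\<lambda>x. coeff (pderiv (pderiv Q)) i) \<in> H" for i
  proof -
    have "coeff (pderiv (pderiv Q)) i = of_rat (of_nat (Suc i) * (of_nat (Suc (Suc i)) * coeff q (Suc (Suc i))))"
      by (simp add: coeff_pderiv Q_def coeff_map_poly of_rat_mult of_rat_add)
    then show ?thesis
      using germ_const_of_rat[OF assms(1)] by presburger
  qed
  then have signed: "eventually_signed (\<lambda>x. g'' x - of_rat r / x)" for r
    using germ_minus_poly_minus_recip_signed[OF assms(1) germ_deriv[OF assms(1) h'] _ germ_const_of_rat[OF assms(1)], of _ r 1]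
    by (simp add: g''_def)

  obtain D where D: "D > 0" "\<And>i. real D * of_rat (coeff q i) \<in> \<int>"
    using rat_poly_common_denominator by blast
  define f where "f n = cis (2 * pi * rat_poly_eval q (real n))" for n :: nat
  have "f (n + D) = f n" for n
  proof -
    have "f (n + D) = f n * cis (2 * pi * (rat_poly_eval q (real (n + D)) - rat_poly_eval q (real n)))"
      unfolding f_def cis_mult by (simp add: algebra_simps)
    also have "\<dots> = f n"
      using rat_poly_eval_periodic_mod_1(2)[of D q, OF D(2)] by simp
    finally show ?thesis .
  qed
  then obtain c where c: "\<And>n. f n = (\<Sum>j<D. c j * cis (2 * pi * (real j / real D)) ^ n)"
    using discrete_Fourier_expansion[OF D(1)] by metis
  \<comment> \<open>At \<open>n = 0\<close> all characters equal 1, and \<open>f 0\<close> has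
    modulus 1; so the coefficients cannot all vanish.\<close>
  have "(\<Sum>j<D. c j) = f 0"
    using c[of 0] by simp
  then have "(\<Sum>j<D. c j) \<noteq> 0"
    by (simp add: f_def)
  then obtain k where k: "k < D" "c k \<noteq> 0"
    by (meson lessThan_iff sum.neutral)
  define \<kappa> where "\<kappa> = real k / real D"
  \<comment> \<open>Twisting by the frequency \<open>- \<kappa>\<close> makes the
    \<open>k\<close>-th character constant. Since \<open>j\<close> and \<open>k\<close> are both
    below \<open>D\<close>, no other character becomes trivial, and the limit is
    \<open>c k\<close>.\<close>
  have "binomial_average (\<lambda>n. \<Sum>j<D. c j * cis (2 * pi * (real j / real D - \<kappa>)) ^ n)
      \<longlonglongrightarrow> (\<Sum>j<D. c j * (if cis (2 * pi * (real j / real D - \<kappa>)) = 1 then 1 else 0))"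
    by (rule binomial_average_sum_powers_tendsto) auto
  also have "(\<lambda>n. \<Sum>j<D. c j * cis (2 * pi * (real j / real D - \<kappa>)) ^ n)
      = (\<lambda>n. cis (2 * pi * (rat_poly_eval q (real n) - \<kappa> * real n)))"
  proof
    fix n
    have "cis (2 * pi * (real j / real D - \<kappa>)) ^ n
        = cis (2 * pi * (real j / real D)) ^ n * cis (- (2 * pi * (\<kappa> * real n)))" for j
      unfolding Complex.DeMoivre cis_mult by (rule arg_cong[of _ _ cis]) (simp add: algebra_simps)
    then have "(\<Sum>j<D. c j * cis (2 * pi * (real j / real D - \<kappa>)) ^ n)
        = f n * cis (- (2 * pi * (\<kappa> * real n)))"
      unfolding c sum_distrib_right by (simp add: mult.assoc)
    then show "(\<Sum>j<D. c j * cis (2 * pi * (real j / real D - \<kappa>)) ^ n)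
        = cis (2 * pi * (rat_poly_eval q (real n) - \<kappa> * real n))"
      by (simp add: f_def cis_mult right_diff_distrib)
  qed
  also have "(\<Sum>j<D. c j * (if cis (2 * pi * (real j / real D - \<kappa>)) = 1 then 1 else 0)) = (\<Sum>j<D. if j = k then c j else 0)"
  proof (intro sum.cong refl)
    fix j assume "j \<in> {..<D}"
    then have "\<bar>real j / real D - \<kappa>\<bar> < 1"
      using k(1) unfolding \<kappa>_def diff_divide_distrib[symmetric] by (simp add: abs_less_iff field_simps)
    then have "real j / real D - \<kappa> \<in> \<int> \<longleftrightarrow> j = k"
      using D(1) by (auto simp: \<kappa>_def dest: Ints_nonzero_abs_less1)
    then show "c j * (if cis (2 * pi * (real j / real D - \<kappa>)) = 1 then 1 else 0) = (if j = k then c j else 0)"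
      unfolding cis_2pi_eq_1_iff by simp
  qed
  finally have lim_k: "binomial_average (\<lambda>n. cis (2 * pi * (rat_poly_eval q (real n) - \<kappa> * real n))) \<longlonglongrightarrow> c k"
    using k(1) by simp

  \<comment> \<open>The constants are tuned so that the linearization error is below
    \<open>2 * \<delta>\<close> and the average of \<open>h\<close> below \<delta>, while the
    twisted average exceeds \<open>3 * \<delta>\<close>.\<close>
  define \<delta> where "\<delta> = norm (c k) / 4"
  define \<epsilon> where "\<epsilon> = \<delta> / (8 * pi)"
  have \<delta>: "\<delta> > 0" and \<epsilon>: "\<epsilon> > 0"
    using k(2) by (auto simp: \<delta>_def \<epsilon>_def)
  have "\<forall>\<^sub>F x in at_top. \<bar>g'' x\<bar> \<le> \<epsilon> / x"
    using signed q unfolding eventually_signed_def g_def[symmetric]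
    by (intro second_deriv_smallo_inverse[OF g' g'' _ _ \<epsilon>])
  from eventually_conj[OF eventually_gt_at_top[of 0] eventually_conj[OF this eventually_conj[OF g' g'']]]
  obtain b where "\<forall>y\<ge>b. 0 < y \<and> \<bar>g'' y\<bar> \<le> \<epsilon> / y \<and>
      (g has_real_derivative g' y) (at y) \<and> (g' has_real_derivative g'' y) (at y)"
    unfolding eventually_at_top_linorder by blast
  then have b: "b > 0" "\<And>y. y \<ge> b \<Longrightarrow> \<bar>g'' y\<bar> \<le> \<epsilon> / y"
      "\<And>y. y \<ge> b \<Longrightarrow> (g has_real_derivative g' y) (at y)"
      "\<And>y. y \<ge> b \<Longrightarrow> (g' has_real_derivative g'' y) (at y)"
    by blast+
  have "(\<lambda>N. 8 / real N) \<longlonglongrightarrow> 0"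
    by (rule lim_const_over_n)
  then have "\<forall>\<^sub>F N in sequentially. 8 / real N < \<delta>"
    using \<delta> by (rule order_tendstoD(2))
  moreover have "\<forall>\<^sub>F N in sequentially. norm (binomial_average (\<lambda>n. cis (2 * pi * h (real n))) N) < \<delta>"
    using order_tendstoD(2)[OF tendsto_norm[OF lim], of \<delta>] \<delta> by simp
  moreover have "\<forall>\<^sub>F N in sequentially.
      3 * \<delta> < norm (binomial_average (\<lambda>n. cis (2 * pi * (rat_poly_eval q (real n) - \<kappa> * real n))) N)"
    using order_tendstoD(1)[OF tendsto_norm[OF lim_k], of "3 * \<delta>"] \<delta> by (simp add: \<delta>_def)
  ultimately have "\<forall>\<^sub>F N in sequentially. 8 / real N < \<delta>
      \<and> norm (binomial_average (\<lambda>n. cis (2 * pi * h (real n))) N) < \<delta>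
      \<and> 3 * \<delta> < norm (binomial_average (\<lambda>n. cis (2 * pi * (rat_poly_eval q (real n) - \<kappa> * real n))) N)"
    by (intro eventually_conj)
  then obtain N\<^sub>0 where N\<^sub>0: "\<And>N. N \<ge> N\<^sub>0 \<Longrightarrow> 8 / real N < \<delta>
      \<and> norm (binomial_average (\<lambda>n. cis (2 * pi * h (real n))) N) < \<delta>
      \<and> 3 * \<delta> < norm (binomial_average (\<lambda>n. cis (2 * pi * (rat_poly_eval q (real n) - \<kappa> * real n))) N)"
    unfolding eventually_sequentially by blast

  \<comment> \<open>The first entry is what the linearization requires of \<open>x\<close>; the
    second ensures that the integer part of \<open>2 * x\<close> reaches
    \<open>N\<^sub>0\<close>.\<close>
  define a where "a = max (2 * b + 1) (real N\<^sub>0)"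
  have "\<exists>x\<ge>a. g' x - (- \<kappa>) \<in> \<int>"
  proof (rule superlinear_deriv_hits_residue)
    show "(g has_real_derivative g' x) (at x)" if "x \<ge> a" for x
      using that b(1) by (intro b) (simp add: a_def)
    show "continuous_on {a..} g'"
      by (rule DERIV_continuous_on[of _ _ g'']) (use b(1) in \<open>auto simp: a_def intro!: has_field_derivative_at_within b(4)\<close>)
    show "filterlim (\<lambda>x. \<bar>g x\<bar> / x) at_top at_top"
      using assms(4)[of q] by (simp add: g_def)
  qed
  then obtain x where x: "x \<ge> a" "g' x + \<kappa> \<in> \<int>" by auto
  define N where "N = nat \<lfloor>2 * x\<rfloor>"
  have "N \<ge> N\<^sub>0"
    using x(1) b(1) unfolding N_def a_def by linarith
  note N = N\<^sub>0[OF this]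
  let ?h = "binomial_average (\<lambda>n. cis (2 * pi * h (real n))) N"
  let ?q = "binomial_average (\<lambda>n. cis (2 * pi * (rat_poly_eval q (real n) - \<kappa> * real n))) N"
  have "norm (?h - cis (2 * pi * (g x - x * g' x)) * ?q) \<le> 8 * pi * \<epsilon> + 8 / real N"
    using binomial_average_linearization[OF b(3,4,2,1) \<epsilon> _ x(2) N_def, of "\<lambda>n. rat_poly_eval q (real n)"] x(1)
    by (simp add: g_def a_def)
  moreover have "8 * pi * \<epsilon> = \<delta>"
    by (simp add: \<epsilon>_def)
  \<comment> \<open>The phase factor has modulus 1, so the twisted average is bounded by less than
    \<open>\<delta> + 2 * \<delta>\<close>, contradicting its lower bound.\<close>
  moreover have "norm ?q \<le> norm ?h + norm (?h - cis (2 * pi * (g x - x * g' x)) * ?q)"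
    using norm_triangle_sub[of "cis (2 * pi * (g x - x * g' x)) * ?q" ?h]
    by (simp add: norm_mult norm_minus_commute)
  ultimately show False
    using N by linarith
qed

end
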